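(* Let $a_i,b_i,\xi_i>0$ $(1\le i\le n)$ be as in the context, let $\mathcal{P}_{\mathrm{tot}},\mathcal{P}_{\max}>0$, and consider $$\min_{\boldsymbol{z}}\ \sum_{i=1}^n\frac{a_ib_i}{z_i+b_i}\quad\text{s.t.}\quad\sum_{i=1}^n\xi_iz_i\le\mathcal{P}_{\mathrm{tot}},\quad z_i\ge0,\quad \xi_iz_i\le\mathcal{P}_{\max}\ \ (1\le i\le n).$$ Then the following two-stage generalized water-filling procedure produces the optimal solution $\boldsymbol{z}$. Stage 1. Let $\beta_i=\sqrt{b_i\xi_i/a_i}$ and $\tilde\beta_i=\dfrac{\mathcal{P}_{\max}+b_i\xi_i}{\sqrt{a_ib_i\xi_i}}$, and index the users so that $\tilde\beta_1\le\cdots\le\tilde\beta_n$. For $1\le i\le\min\{n,\lfloor\mathcal{P}_{\mathrm{tot}}/\mathcal{P}_{\max}\rfloor\}$ let $\tilde{\mathcal{S}}_i=\{m:\ i<m\le n,\ \beta_m<\tilde\beta_i\}$ and $$\tilde f(i)=\frac{\tilde\beta_i\sum_{m\in\tilde{\mathcal{S}}_i}\sqrt{a_mb_m\xi_m}}{\mathcal{P}_{\mathrm{tot}}-i\,\mathcal{P}_{\max}+\sum_{m\in\tilde{\mathcal{S}}_i}b_m\xi_m}$$ (with $\tilde f(i):=1$ if numerator and denominator are both $0$). Let $\mathcal{S}_1=\{1,\dots,i_{\mathcal{S}}\}$, where $i_{\mathcal{S}}$ is the largest index in this range with $\tilde f(i_{\mathcal{S}})<1$ ($\mathcal{S}_1=\emptyset$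 if there is none). Set $z_i=\mathcal{P}_{\max}/\xi_i$ for $i\in\mathcal{S}_1$. Stage 2. If $\mathcal{S}_1\ne\{1,\dots,n\}$, put $n'=n-|\mathcal{S}_1|$ and $\mathcal{P}'=\mathcal{P}_{\mathrm{tot}}-|\mathcal{S}_1|\mathcal{P}_{\max}$, and list the users not in $\mathcal{S}_1$ as $j_1,\dots,j_{n'}$ with $\beta_{j_1}\le\cdots\le\beta_{j_{n'}}$. Let $$f(l)=\frac{\beta_{j_l}\sum_{k=1}^{l}\sqrt{a_{j_k}b_{j_k}\xi_{j_k}}}{\mathcal{P}'+\sum_{k=1}^{l}b_{j_k}\xi_{j_k}},\qquad1\le l\le n',$$ and let $\mathcal{S}_2=\{j_1,\dots,j_{n'}\}$ if $f(n')<1$, and otherwise $\mathcal{S}_2=\{j_1,\dots,j_{l^*}\}$, where $l^*$ is the index with $f(l^* )<1$ and $f(l^*+1)\ge1$. Set $$z_i=\frac{\tilde\kappa_i\tilde\sigma_v^2}{|h_i|^2}\left(\frac{\gamma_i|h_i|}{\sqrt{\xi_i}}\,\eta-1\right)\ (i\in\mathcal{S}_2),\qquad \eta=\frac{\sum_{i\in\mathcal{S}_2}\tilde\kappa_i\xi_i/|h_i|^2+\mathcal{P}'/\tilde\sigma_v^2}{\sum_{i\in\mathcal{S}_2}\tilde\kappa_i\sqrt{\xi_i}\,\gamma_i/|h_i|},$$ and $z_i=0$ for $i\notin\mathcal{S}_1\cup\mathcal{S}_2$.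
   Context: Let $n\ge1$ be the number of secondary users. For each $i\in\{1,\dots,n\}$, $\gamma_i>0$ is the local received SNR, $h_i\in\mathbb{C}\setminus\{0\}$ the fusion channel gain and $\tilde\kappa_i>0$ the fixed number of samples. Let $\sigma_n^2,\sigma_v^2>0$ be noise variances and $\tilde\sigma_v^2=\sigma_v^2/\sigma_n^4$ with $\tilde\sigma_v>0$. Put $\xi_i=(1+2\pi_1\gamma_i)\sigma_n^4$ with $\pi_1=1/2$, $a_i=\tilde\kappa_i\gamma_i^2$ and $b_i=\tilde\kappa_i\tilde\sigma_v^2/|h_i|^2$. The problem is the minimization of the error probability $$Q\left(\frac12\Big(\sum_{i=1}^n\frac{g_i^2\tilde\kappa_i\gamma_i^2|h_i|^2}{g_i^2|h_i|^2+\tilde\kappa_i\tilde\sigma_v^2}\Big)^{1/2}\right),\qquad Q(x)=\frac1{\sqrt{2\pi}}\int_x^\infty e^{-t^2/2}\,dt,$$ over amplifier gains $g_i\ge0$ with $z_i=g_i^2$, under a global transmission power budget $\mathcal{P}_{\mathrm{tot}}$ and an individual power limit $\mathcal{P}_{\max}$. *)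

theory Defs
  imports Complex_Main
begin

text \<open>Users are the indices \<open>1, \<dots>, n\<close>; a power allocation is a function \<open>z :: nat \<Rightarrow> real\<close> of
  which only the values on \<open>{1..n}\<close> matter.\<close>

definition objective :: "nat \<Rightarrow> (nat \<Rightarrow> real) \<Rightarrow> (nat \<Rightarrow> real) \<Rightarrow> (nat \<Rightarrow> real) \<Rightarrow> real" where
  "objective n a b z = (\<Sum>i=1..n. a i * b i / (z i + b i))"

definition feasible :: "nat \<Rightarrow> (nat \<Rightarrow> real) \<Rightarrow> real \<Rightarrow> real \<Rightarrow> (nat \<Rightarrow> real) \<Rightarrow> bool" where
  "feasible n \<xi> Ptot Pmax z \<longleftrightarrow>
     (\<Sum>i=1..n. \<xi> i * z i) \<le> Ptot \<and> (\<forall>i\<in>{1..n}. 0 \<le> z i \<and> \<xi> i * z i \<le> Pmax)"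

definition beta :: "(nat \<Rightarrow> real) \<Rightarrow> (nat \<Rightarrow> real) \<Rightarrow> (nat \<Rightarrow> real) \<Rightarrow> nat \<Rightarrow> real" where
  "beta a b \<xi> i = sqrt (b i * \<xi> i / a i)"

definition beta_tilde ::
    "(nat \<Rightarrow> real) \<Rightarrow> (nat \<Rightarrow> real) \<Rightarrow> (nat \<Rightarrow> real) \<Rightarrow> real \<Rightarrow> nat \<Rightarrow> real" where
  "beta_tilde a b \<xi> Pmax i = (Pmax + b i * \<xi> i) / sqrt (a i * b i * \<xi> i)"

text \<open>\<open>e 1, \<dots>, e k\<close> lists the elements of \<open>A\<close> without repetition in nondecreasing order of
  \<open>key\<close>; ties may be broken in any way.\<close>

definition sorted_listing :: "nat \<Rightarrow> nat set \<Rightarrow> (nat \<Rightarrow> real) \<Rightarrow> (nat \<Rightarrow> nat) \<Rightarrow> bool" where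
  "sorted_listing k A key e \<longleftrightarrow> bij_betw e {1..k} A \<and> mono_on {1..k} (\<lambda>i. key (e i))"

text \<open>Stage 1. Indexing the users so that \<open>beta_tilde\<close> is nondecreasing is expressed by a
  listing \<open>u\<close>: the user with the new index \<open>i\<close> is \<open>u i\<close>. Accordingly \<open>S_tilde\<close> consists of new
  indices, while \<open>S_one\<close> consists of users.\<close>

definition S_tilde ::
    "nat \<Rightarrow> (nat \<Rightarrow> real) \<Rightarrow> (nat \<Rightarrow> real) \<Rightarrow> (nat \<Rightarrow> real) \<Rightarrow> real \<Rightarrow> (nat \<Rightarrow> nat) \<Rightarrow> nat \<Rightarrow> nat set"
  where
  "S_tilde n a b \<xi> Pmax u i =
     {m. i < m \<and> m \<le> n \<and> beta a b \<xi> (u m) < beta_tilde a b \<xi> Pmax (u i)}"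

definition f_tilde ::
    "nat \<Rightarrow> (nat \<Rightarrow> real) \<Rightarrow> (nat \<Rightarrow> real) \<Rightarrow> (nat \<Rightarrow> real) \<Rightarrow> real \<Rightarrow> real \<Rightarrow> (nat \<Rightarrow> nat)
       \<Rightarrow> nat \<Rightarrow> real" where
  "f_tilde n a b \<xi> Ptot Pmax u i =
     (let num = beta_tilde a b \<xi> Pmax (u i) *
                (\<Sum>m\<in>S_tilde n a b \<xi> Pmax u i. sqrt (a (u m) * b (u m) * \<xi> (u m)));
          den = Ptot - real i * Pmax + (\<Sum>m\<in>S_tilde n a b \<xi> Pmax u i. b (u m) * \<xi> (u m))
      in if num = 0 \<and> den = 0 then 1 else num / den)"

definition i_S ::
    "nat \<Rightarrow> (nat \<Rightarrow> real) \<Rightarrow> (nat \<Rightarrow> real) \<Rightarrow> (nat \<Rightarrow> real) \<Rightarrow> real \<Rightarrow> real \<Rightarrow> (nat \<Rightarrow> nat) \<Rightarrow> nat"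
  where
  "i_S n a b \<xi> Ptot Pmax u =
     (let I = {i \<in> {1..min n (nat \<lfloor>Ptot / Pmax\<rfloor>)}. f_tilde n a b \<xi> Ptot Pmax u i < 1}
      in if I = {} then 0 else Max I)"

definition S_one ::
    "nat \<Rightarrow> (nat \<Rightarrow> real) \<Rightarrow> (nat \<Rightarrow> real) \<Rightarrow> (nat \<Rightarrow> real) \<Rightarrow> real \<Rightarrow> real \<Rightarrow> (nat \<Rightarrow> nat) \<Rightarrow> nat set"
  where
  "S_one n a b \<xi> Ptot Pmax u = u ` {1..i_S n a b \<xi> Ptot Pmax u}"

text \<open>Stage 2, for the remaining \<open>k\<close> users, listed as \<open>j 1, \<dots>, j k\<close> in nondecreasing order of
  \<open>beta\<close>, and the remaining power \<open>P\<close>. Since \<open>f_two\<close> is below \<open>1\<close> on an initial segment of \<open>{1..k}\<close> only,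
  nonempty whenever \<open>P > 0\<close>, the index selected by \<open>THE\<close> exists and is unique.\<close>

definition f_two ::
    "(nat \<Rightarrow> real) \<Rightarrow> (nat \<Rightarrow> real) \<Rightarrow> (nat \<Rightarrow> real) \<Rightarrow> real \<Rightarrow> (nat \<Rightarrow> nat) \<Rightarrow> nat \<Rightarrow> real" where
  "f_two a b \<xi> P j l =
     beta a b \<xi> (j l) * (\<Sum>k=1..l. sqrt (a (j k) * b (j k) * \<xi> (j k))) /
     (P + (\<Sum>k=1..l. b (j k) * \<xi> (j k)))"

definition S_two ::
    "(nat \<Rightarrow> real) \<Rightarrow> (nat \<Rightarrow> real) \<Rightarrow> (nat \<Rightarrow> real) \<Rightarrow> real \<Rightarrow> nat \<Rightarrow> (nat \<Rightarrow> nat) \<Rightarrow> nat set" where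
  "S_two a b \<xi> P k j =
     (if f_two a b \<xi> P j k < 1 then j ` {1..k}
      else j ` {1..(THE l. 1 \<le> l \<and> l < k \<and> f_two a b \<xi> P j l < 1 \<and> f_two a b \<xi> P j (l + 1) \<ge> 1)})"

end

theory Submission
  imports Defs
begin

text \<open>With \<open>p\<^sub>i = \<xi>\<^sub>i z\<^sub>i\<close>, \<open>s\<^sub>i = sqrt (a\<^sub>i b\<^sub>i \<xi>\<^sub>i)\<close> and \<open>c\<^sub>i = b\<^sub>i \<xi>\<^sub>i\<close>, the objective is
  the sum of the \<open>s\<^sub>i\<^sup>2 / (p\<^sub>i + c\<^sub>i)\<close>, and the optimality conditions read: for some water level \<open>t\<close>,
  \<open>p\<^sub>i\<close> is \<open>s\<^sub>i t - c\<^sub>i\<close> clamped to \<open>[0, Pmax]\<close>, and the \<open>p\<^sub>i\<close> add up to the budget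
  (unless every user can be saturated within it). User \<open>i\<close> is idle
  iff \<open>t \<le> \<beta>\<^sub>i\<close> and saturated iff \<open>t \<ge> \<beta>~\<^sub>i\<close>. Each test \<open>f < 1\<close> of the procedure asks whether the power
  spent at one of these thresholds is still below the budget, i.e. whether the threshold lies below
  the optimal level; so stage 1 finds the saturated users and stage 2 the idle ones.\<close>

text \<open>A convex objective under linear constraints, so multipliers certify a minimum. \<mu>
  belongs to the budget; the multipliers of the box constraints are eliminated, which leaves the
  one-sided conditions \<open>unsat\<close> and \<open>active\<close>. Uniqueness comes from keeping
  the quadratic remainder of the tangent bound instead of dropping it.\<close>

lemma unique_arg_min_if_KKT:
  fixes a b \<xi> z :: "nat \<Rightarrow> real"
  assumes pos: "\<And>i. i \<in> {1..n} \<Longrightarrow> a i > 0 \<and> b i > 0 \<and> \<xi> i > 0"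
    and feas: "feasible n \<xi> Ptot Pmax z"
    and mu: "\<mu> \<ge> 0" "\<mu> * (Ptot - (\<Sum>i=1..n. \<xi> i * z i)) = 0"
    and unsat: "\<And>i. i \<in> {1..n} \<Longrightarrow> \<xi> i * z i < Pmax \<Longrightarrow> a i * b i / (z i + b i)\<^sup>2 \<le> \<mu> * \<xi> i"
    and active: "\<And>i. i \<in> {1..n} \<Longrightarrow> 0 < z i \<Longrightarrow> \<mu> * \<xi> i \<le> a i * b i / (z i + b i)\<^sup>2"
  shows "is_arg_min (objective n a b) (feasible n \<xi> Ptot Pmax) z \<and>
         (\<forall>w. is_arg_min (objective n a b) (feasible n \<xi> Ptot Pmax) w \<longrightarrow> (\<forall>i\<in>{1..n}. w i = z i))"
proof -
  \<comment> \<open>The exact error of the tangent of \<open>a i * b i / (x + b i)\<close> at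
    \<open>x = z i\<close>, evaluated at \<open>x = w i\<close>. It is nonnegative and vanishes only
    for \<open>w i = z i\<close>.\<close>
  define gap where
    "gap w i = a i * b i * (w i - z i)\<^sup>2 / ((w i + b i) * (z i + b i)\<^sup>2)" for w :: "nat \<Rightarrow> real" and i
  have gap_nonneg: "gap w i \<ge> 0" and gap_0: "gap w i = 0 \<Longrightarrow> w i = z i"
    if "feasible n \<xi> Ptot Pmax w" "i \<in> {1..n}" for w i
  proof -
    have "w i + b i > 0" "z i + b i > 0" "a i > 0" "b i > 0"
      using that feas pos[of i] by (auto simp: feasible_def intro: add_nonneg_pos)
    then show "gap w i \<ge> 0" "gap w i = 0 \<Longrightarrow> w i = z i"
      unfolding gap_def by auto
  qed
  have key: "(\<Sum>i=1..n. gap w i) \<le> objective n a b w - objective n a b z"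
    if w: "feasible n \<xi> Ptot Pmax w" for w
  proof -
    have user: "gap w i \<le> a i * b i / (w i + b i) - a i * b i / (z i + b i) + \<mu> * (\<xi> i * w i - \<xi> i * z i)"
      if i: "i \<in> {1..n}" for i
    proof -
      have p: "a i > 0" "b i > 0" "\<xi> i > 0" "0 \<le> w i" "0 \<le> z i" "\<xi> i * w i \<le> Pmax" "\<xi> i * z i \<le> Pmax"
        using i w feas pos[of i] by (auto simp: feasible_def)
      then have q: "w i + b i > 0" "z i + b i > 0"
        by linarith+
      have "1 / x - 1 / y + (x - y) / y\<^sup>2 = (x - y)\<^sup>2 / (x * y\<^sup>2)" if "x > 0" "y > 0" for x y :: real
        using that by (simp add: field_simps power2_eq_square)
      from arg_cong[OF this[OF q], of "\<lambda>x. a i * b i * x"]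
      have eq: "a i * b i / (w i + b i) - a i * b i / (z i + b i) = gap w i - a i * b i / (z i + b i)\<^sup>2 * (w i - z i)"
        unfolding gap_def by (simp add: algebra_simps)
      \<comment> \<open>Both factors have the same sign: moving below \<open>z i\<close> requires
        \<open>0 < z i\<close>, so \<open>active\<close> applies; moving above it requires room
        below \<open>Pmax\<close>, so \<open>unsat\<close> applies.\<close>
      have "0 \<le> (\<mu> * \<xi> i - a i * b i / (z i + b i)\<^sup>2) * (w i - z i)"
      proof (cases "w i < z i")
        case True
        then have "\<mu> * \<xi> i - a i * b i / (z i + b i)\<^sup>2 \<le> 0"
          using active[OF i] p by linarith
        with True show ?thesis by (intro mult_nonpos_nonpos) auto
      next
        case False
        show ?thesis
        proof (cases "w i = z i")
          case False
          with \<open>\<not> w i < z i\<close> have lt: "z i < w i" by simp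
          then have "\<xi> i * z i < Pmax"
            using p by (meson mult_strict_left_mono order_less_le_trans)
          with unsat[OF i] lt show ?thesis by (intro mult_nonneg_nonneg) auto
        qed simp
      qed
      with eq show ?thesis by (simp add: algebra_simps)
    qed
    have "(\<Sum>i=1..n. gap w i) \<le> (\<Sum>i=1..n. a i * b i / (w i + b i) - a i * b i / (z i + b i) +
        \<mu> * (\<xi> i * w i - \<xi> i * z i))"
      by (intro sum_mono user)
    also have "\<dots> = objective n a b w - objective n a b z +
        \<mu> * ((\<Sum>i=1..n. \<xi> i * w i) - (\<Sum>i=1..n. \<xi> i * z i))"
      by (simp add: objective_def sum.distrib sum_subtractf flip: sum_distrib_left)
    also have "\<mu> * ((\<Sum>i=1..n. \<xi> i * w i) - (\<Sum>i=1..n. \<xi> i * z i)) =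
        \<mu> * ((\<Sum>i=1..n. \<xi> i * w i) - Ptot)"
      using mu(2) by (simp add: algebra_simps)
    also have "\<dots> \<le> 0"
      using mu(1) w by (intro mult_nonneg_nonpos) (auto simp: feasible_def)
    finally show ?thesis by simp
  qed
  have gaps: "(\<Sum>i=1..n. gap w i) \<ge> 0" if "feasible n \<xi> Ptot Pmax w" for w
    using that by (intro sum_nonneg gap_nonneg)
  have min: "is_arg_min (objective n a b) (feasible n \<xi> Ptot Pmax) z"
    unfolding is_arg_min_def using feas key gaps by fastforce
  moreover have "w i = z i"
    if w: "is_arg_min (objective n a b) (feasible n \<xi> Ptot Pmax) w" and i: "i \<in> {1..n}" for w i
  proof -
    have fw: "feasible n \<xi> Ptot Pmax w" and "\<not> objective n a b z < objective n a b w"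
      using w feas by (auto simp: is_arg_min_def)
    then have "(\<Sum>i=1..n. gap w i) = 0"
      using key[OF fw] gaps[OF fw] by linarith
    then have "gap w i = 0"
      using gap_nonneg[OF fw] i by (subst (asm) sum_nonneg_eq_0_iff) auto
    then show ?thesis using gap_0[OF fw i] by simp
  qed
  ultimately show ?thesis by blast
qed

section \<open>Water levels, thresholds and spent power\<close>

locale water_filling =
  fixes n :: nat and a b \<xi> :: "nat \<Rightarrow> real" and Ptot Pmax :: real
  assumes pos: "\<And>i. i \<in> {1..n} \<Longrightarrow> a i > 0 \<and> b i > 0 \<and> \<xi> i > 0"
    and Ptot: "Ptot > 0" and Pmax: "Pmax > 0"
begin

definition s :: "nat \<Rightarrow> real" where "s i = sqrt (a i * b i * \<xi> i)"

definition c :: "nat \<Rightarrow> real" where "c i = b i * \<xi> i"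

abbreviation "\<beta> \<equiv> beta a b \<xi>"
abbreviation "\<beta>t \<equiv> beta_tilde a b \<xi> Pmax"

text \<open>The power that the users in \<open>A\<close> spend at water level \<open>t\<close> when
  only nonnegativity is enforced; \<open>capped\<close> also enforces the individual limit.\<close>

definition uncapped :: "nat set \<Rightarrow> real \<Rightarrow> real" where
  "uncapped A t = (\<Sum>i\<in>A. max 0 (s i * t - c i))"

definition capped :: "nat set \<Rightarrow> real \<Rightarrow> real" where
  "capped A t = (\<Sum>i\<in>A. max 0 (min Pmax (s i * t - c i)))"

text \<open>A user counts as saturated if filling up to its threshold \<open>\<beta>t i\<close>
  stays strictly within the budget. No ordering of the users enters, so the way ties are broken in a
  listing cannot matter; \<open>active\<close> is defined in the same spirit.\<close>

definition saturated :: "nat set" where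
  "saturated = {i \<in> {1..n}. capped {1..n} (\<beta>t i) < Ptot}"

definition residual :: real where
  "residual = Ptot - real (card saturated) * Pmax"

definition active :: "nat set" where
  "active = {i \<in> {1..n} - saturated. uncapped ({1..n} - saturated) (\<beta> i) < residual}"

definition level :: real where
  "level = (residual + (\<Sum>i\<in>active. c i)) / (\<Sum>i\<in>active. s i)"

lemma s_pos: "i \<in> {1..n} \<Longrightarrow> s i > 0"
  and c_pos: "i \<in> {1..n} \<Longrightarrow> c i > 0"
  using pos[of i] by (auto simp: s_def c_def)

text \<open>Identifies \<open>\<beta> i\<close> as the level at which the unclamped power
  \<open>s i * t - c i\<close> vanishes; \<open>s_beta_tilde\<close> likewise makes
  \<open>\<beta>t i\<close> the level at which it reaches \<open>Pmax\<close>.\<close>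

lemma s_beta:
  assumes "i \<in> {1..n}"
  shows "s i * \<beta> i = c i"
proof -
  have "s i * \<beta> i = sqrt ((b i * \<xi> i)\<^sup>2)"
    unfolding s_def beta_def using pos[OF assms]
    by (subst real_sqrt_mult[symmetric]) (simp add: field_simps power2_eq_square)
  then show ?thesis using pos[OF assms] by (simp add: c_def)
qed

lemma s_beta_tilde: "i \<in> {1..n} \<Longrightarrow> s i * \<beta>t i = Pmax + c i"
  using s_pos[of i] unfolding beta_tilde_def by (simp flip: s_def c_def)

lemma le_beta_iff: "i \<in> {1..n} \<Longrightarrow> t \<le> \<beta> i \<longleftrightarrow> s i * t - c i \<le> 0"
  using mult_le_cancel_left_pos[OF s_pos, of i t "\<beta> i"] s_beta[of i] by simp

lemma le_beta_tilde_iff: "i \<in> {1..n} \<Longrightarrow> t \<le> \<beta>t i \<longleftrightarrow> s i * t - c i \<le> Pmax"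
  using mult_le_cancel_left_pos[OF s_pos, of i t "\<beta>t i"] s_beta_tilde[of i] by linarith

lemma beta_tilde_le_iff: "i \<in> {1..n} \<Longrightarrow> \<beta>t i \<le> t \<longleftrightarrow> Pmax \<le> s i * t - c i"
  using mult_le_cancel_left_pos[OF s_pos, of i "\<beta>t i" t] s_beta_tilde[of i] by linarith

lemma uncapped_mono:
  assumes "A \<subseteq> {1..n}" "x \<le> y"
  shows "uncapped A x \<le> uncapped A y"
  unfolding uncapped_def
proof (rule sum_mono)
  fix i assume "i \<in> A"
  then have "s i * x \<le> s i * y"
    using assms s_pos[of i] by (intro mult_left_mono) auto
  then show "max 0 (s i * x - c i) \<le> max 0 (s i * y - c i)" by simp
qed

lemma capped_mono:
  assumes "A \<subseteq> {1..n}" "x \<le> y"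
  shows "capped A x \<le> capped A y"
  unfolding capped_def
proof (rule sum_mono)
  fix i assume "i \<in> A"
  then have "s i * x \<le> s i * y"
    using assms s_pos[of i] by (intro mult_left_mono) auto
  then show "max 0 (min Pmax (s i * x - c i)) \<le> max 0 (min Pmax (s i * y - c i))" by simp
qed

lemma capped_le_uncapped: "capped A t \<le> uncapped A t"
  unfolding capped_def uncapped_def by (intro sum_mono) auto

lemma capped_nonneg: "capped A t \<ge> 0"
  unfolding capped_def by (intro sum_nonneg) auto

lemma capped_le_card: "capped A t \<le> real (card A) * Pmax"
  unfolding capped_def using Pmax by (intro sum_bounded_above) auto

lemma capped_eq_card:
  assumes "A \<subseteq> {1..n}" "\<And>i. i \<in> A \<Longrightarrow> \<beta>t i \<le> t"
  shows "capped A t = real (card A) * Pmax"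
proof -
  have "capped A t = (\<Sum>i\<in>A. Pmax)"
    unfolding capped_def using assms Pmax beta_tilde_le_iff[of _ t] by (intro sum.cong refl) fastforce
  then show ?thesis by simp
qed

lemma capped_eq_uncapped:
  assumes "A \<subseteq> {1..n}" "\<And>i. i \<in> A \<Longrightarrow> t \<le> \<beta>t i"
  shows "capped A t = uncapped A t"
  unfolding capped_def uncapped_def
proof (rule sum.cong)
  fix i assume "i \<in> A"
  then have "s i * t - c i \<le> Pmax" using assms le_beta_tilde_iff by blast
  then show "max 0 (min Pmax (s i * t - c i)) = max 0 (s i * t - c i)" by simp
qed simp

lemma uncapped_eq_sum:
  assumes "A \<subseteq> {1..n}" "B \<subseteq> A"
    and "\<And>i. i \<in> B \<Longrightarrow> \<beta> i \<le> t" "\<And>i. i \<in> A - B \<Longrightarrow> t \<le> \<beta> i"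
  shows "uncapped A t = (\<Sum>i\<in>B. s i) * t - (\<Sum>i\<in>B. c i)"
proof -
  have "uncapped A t = (\<Sum>i\<in>B. max 0 (s i * t - c i))"
    unfolding uncapped_def
  proof (rule sum.mono_neutral_right)
    show "finite A" using assms(1) finite_subset by blast
    show "\<forall>i\<in>A - B. max 0 (s i * t - c i) = 0"
      using assms(1,4) le_beta_iff by fastforce
  qed fact
  also have "\<dots> = (\<Sum>i\<in>B. s i * t - c i)"
  proof (rule sum.cong)
    fix i assume i: "i \<in> B"
    then have "s i * \<beta> i \<le> s i * t"
      using assms s_pos[of i] by (intro mult_left_mono) auto
    then show "max 0 (s i * t - c i) = s i * t - c i"
      using i assms s_beta[of i] by auto
  qed simp
  finally show ?thesis by (simp add: sum_subtractf sum_distrib_right)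
qed

text \<open>Unlike \<open>uncapped_eq_sum\<close>, this needs no relation between \<open>t\<close>
  and the thresholds: clamping at 0 and adding users only increase the sum.\<close>

lemma uncapped_ge_sum:
  assumes "finite A" "B \<subseteq> A"
  shows "(\<Sum>i\<in>B. s i) * t - (\<Sum>i\<in>B. c i) \<le> uncapped A t"
proof -
  have "(\<Sum>i\<in>B. s i) * t - (\<Sum>i\<in>B. c i) = (\<Sum>i\<in>B. s i * t - c i)"
    by (simp add: sum_subtractf sum_distrib_right)
  also have "\<dots> \<le> (\<Sum>i\<in>B. max 0 (s i * t - c i))"
    by (intro sum_mono) auto
  also have "\<dots> \<le> uncapped A t"
    unfolding uncapped_def using assms by (intro sum_mono2) auto
  finally show ?thesis .
qed

section \<open>Saturated users and the power they leave\<close>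

lemma capped_split: "capped {1..n} t = capped saturated t + capped ({1..n} - saturated) t"
  unfolding capped_def by (subst sum.subset_diff[of saturated]) (auto simp: saturated_def)

lemma saturated_subset: "saturated \<subseteq> {1..n}"
  by (auto simp: saturated_def)

lemma finite_saturated: "finite saturated"
  using saturated_subset finite_subset by blast

lemma beta_tilde_saturated_less:
  assumes "i \<in> saturated" "k \<in> {1..n} - saturated"
  shows "\<beta>t i < \<beta>t k"
proof (rule ccontr)
  assume "\<not> \<beta>t i < \<beta>t k"
  then have "capped {1..n} (\<beta>t k) \<le> capped {1..n} (\<beta>t i)"
    by (intro capped_mono) auto
  with assms show False by (auto simp: saturated_def)
qed

text \<open>At the largest saturated threshold the saturated users spend exactly \<open>Pmax\<close>
  each, while the others are still below their caps, so \<open>capped\<close> and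
  \<open>uncapped\<close> agree on them. Subtracting the saturated share from the budget gives the
  bound there, and monotonicity gives it at the smaller thresholds.\<close>

lemma uncapped_saturated_less:
  assumes "i \<in> saturated"
  shows "uncapped ({1..n} - saturated) (\<beta>t i) < residual"
proof -
  have "Max (\<beta>t ` saturated) \<in> \<beta>t ` saturated"
    using assms finite_saturated by (intro Max_in) auto
  then obtain m where "m \<in> saturated" and m: "\<beta>t m = Max (\<beta>t ` saturated)"
    by auto
  then have max: "m \<in> saturated" "\<And>k. k \<in> saturated \<Longrightarrow> \<beta>t k \<le> \<beta>t m"
    using finite_saturated by auto
  have "capped {1..n} (\<beta>t m) < Ptot"
    using max(1) by (auto simp: saturated_def)
  moreover have "capped saturated (\<beta>t m) = real (card saturated) * Pmax"
    using max saturated_subset by (intro capped_eq_card) auto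
  moreover have "capped ({1..n} - saturated) (\<beta>t m) = uncapped ({1..n} - saturated) (\<beta>t m)"
    using max beta_tilde_saturated_less by (intro capped_eq_uncapped) (auto intro: less_imp_le)
  ultimately have "uncapped ({1..n} - saturated) (\<beta>t m) < residual"
    using capped_split[of "\<beta>t m"] unfolding residual_def by linarith
  moreover have "uncapped ({1..n} - saturated) (\<beta>t i) \<le> uncapped ({1..n} - saturated) (\<beta>t m)"
    using max(2) assms by (intro uncapped_mono) auto
  ultimately show ?thesis by simp
qed

lemma residual_pos: "residual > 0"
proof (cases "saturated = {}")
  case True
  then show ?thesis using Ptot by (simp add: residual_def)
next
  case False
  then obtain i where "i \<in> saturated" by blast
  then have "uncapped ({1..n} - saturated) (\<beta>t i) < residual"
    by (rule uncapped_saturated_less)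
  moreover have "0 \<le> uncapped ({1..n} - saturated) (\<beta>t i)"
    using capped_nonneg capped_le_uncapped by (rule order_trans)
  ultimately show ?thesis by simp
qed

section \<open>Active users and the optimal water level\<close>

lemma active_subset: "active \<subseteq> {1..n} - saturated"
  by (auto simp: active_def)

lemma finite_active: "finite active"
  using active_subset finite_subset by blast

text \<open>At the smallest remaining \<open>\<beta>\<close> nobody outside \<open>saturated\<close>
  spends anything, and \<open>residual\<close> is positive.\<close>

lemma active_nonempty:
  assumes "saturated \<noteq> {1..n}"
  shows "active \<noteq> {}"
proof -
  let ?A = "{1..n} - saturated"
  let ?m = "arg_min_on \<beta> ?A"
  have "?A \<noteq> {}" using assms saturated_subset by blast
  then have min: "?m \<in> ?A" "\<And>k. k \<in> ?A \<Longrightarrow> \<beta> ?m \<le> \<beta> k"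
    using arg_min_if_finite[of ?A \<beta>] by (auto simp: not_less)
  have "uncapped ?A (\<beta> ?m) = 0"
    using uncapped_eq_sum[of ?A "{}" "\<beta> ?m"] min(2) by simp
  then have "?m \<in> active" using min(1) residual_pos by (simp add: active_def)
  then show ?thesis by blast
qed

context
  assumes unsat: "saturated \<noteq> {1..n}"
begin

lemma sum_active_pos: "(\<Sum>i\<in>active. s i) > 0"
  using active_nonempty[OF unsat] finite_active active_subset s_pos
  by (intro sum_pos) auto

lemma sum_active_level: "(\<Sum>i\<in>active. s i) * level - (\<Sum>i\<in>active. c i) = residual"
  using sum_active_pos by (simp add: level_def)

text \<open>The affine spending of the active users alone bounds \<open>uncapped\<close> from below,
  increases in \<open>t\<close>, and reaches \<open>residual\<close> exactly at
  \<open>level\<close>.\<close>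

lemma less_level_if_uncapped:
  assumes "uncapped ({1..n} - saturated) t < residual"
  shows "t < level"
proof (rule ccontr)
  assume "\<not> t < level"
  then have "(\<Sum>i\<in>active. s i) * level \<le> (\<Sum>i\<in>active. s i) * t"
    using sum_active_pos by (intro mult_left_mono) auto
  then have "residual \<le> (\<Sum>i\<in>active. s i) * t - (\<Sum>i\<in>active. c i)"
    using sum_active_level by linarith
  also have "\<dots> \<le> uncapped ({1..n} - saturated) t"
    using active_subset by (intro uncapped_ge_sum) auto
  finally show False using assms by simp
qed

lemma beta_less_level: "i \<in> active \<Longrightarrow> \<beta> i < level"
  by (rule less_level_if_uncapped) (simp add: active_def)

lemma level_pos: "level > 0"
proof -
  have "(\<Sum>i\<in>active. c i) \<ge> 0"
    using active_subset by (intro sum_nonneg less_imp_le[OF c_pos]) auto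
  then show ?thesis
    using residual_pos sum_active_pos by (simp add: level_def)
qed

text \<open>Take the idle user of least \<open>\<beta>\<close>. All active users have thresholds at
  or below this value and all idle ones at or above it, so spending there is given by the same
  affine function that defines \<open>level\<close>. It is at least \<open>residual\<close> because
  that user is not active.\<close>

lemma level_le_beta:
  assumes "i \<in> {1..n} - saturated - active"
  shows "level \<le> \<beta> i"
proof -
  let ?A = "{1..n} - saturated"
  let ?m = "arg_min_on \<beta> (?A - active)"
  have "?A - active \<noteq> {}" using assms by auto
  then have min: "?m \<in> ?A - active" "\<And>k. k \<in> ?A - active \<Longrightarrow> \<beta> ?m \<le> \<beta> k"
    using arg_min_if_finite[of "?A - active" \<beta>] by (auto simp: not_less)
  have "\<beta> k \<le> \<beta> ?m" if "k \<in> active" for k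
  proof (rule ccontr)
    assume "\<not> \<beta> k \<le> \<beta> ?m"
    then have "uncapped ?A (\<beta> ?m) \<le> uncapped ?A (\<beta> k)"
      by (intro uncapped_mono) auto
    with that min(1) show False by (auto simp: active_def)
  qed
  then have "uncapped ?A (\<beta> ?m) = (\<Sum>i\<in>active. s i) * \<beta> ?m - (\<Sum>i\<in>active. c i)"
    using min(2) active_subset by (intro uncapped_eq_sum) auto
  moreover have "residual \<le> uncapped ?A (\<beta> ?m)"
    using min(1) unfolding active_def by (auto simp: not_less simp del: atLeastAtMost_iff)
  ultimately have "(\<Sum>i\<in>active. s i) * level \<le> (\<Sum>i\<in>active. s i) * \<beta> ?m"
    using sum_active_level by linarith
  then have "level \<le> \<beta> ?m" using sum_active_pos by simp
  also have "\<dots> \<le> \<beta> i" using min(2) assms by blast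
  finally show ?thesis .
qed

lemma uncapped_level: "uncapped ({1..n} - saturated) level = residual"
  using uncapped_eq_sum[of "{1..n} - saturated" active level]
    active_subset beta_less_level level_le_beta sum_active_level
  by (force intro: less_imp_le)

lemma beta_tilde_le_level: "i \<in> saturated \<Longrightarrow> \<beta>t i \<le> level"
  by (intro less_imp_le less_level_if_uncapped uncapped_saturated_less)

text \<open>At the threshold of an unsaturated user the capped spending reaches \<open>Ptot\<close>,
  and the saturated users account for at most their caps, so the others spend at least
  \<open>residual\<close> there. A strictly higher \<open>level\<close> would make them spend more
  than \<open>residual\<close>.\<close>

lemma level_le_beta_tilde:
  assumes "i \<in> {1..n} - saturated"
  shows "level \<le> \<beta>t i"
proof (rule ccontr)
  let ?A = "{1..n} - saturated"
  assume *: "\<not> level \<le> \<beta>t i"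
  obtain k where k: "k \<in> active" using active_nonempty[OF unsat] by blast
  have "Ptot \<le> capped {1..n} (\<beta>t i)"
    using assms by (auto simp: saturated_def not_less)
  also have "\<dots> \<le> real (card saturated) * Pmax + uncapped ?A (\<beta>t i)"
    unfolding capped_split by (intro add_mono capped_le_card capped_le_uncapped)
  finally have "residual \<le> uncapped ?A (\<beta>t i)"
    by (simp add: residual_def)
  also have "\<dots> < uncapped ?A level"
    unfolding uncapped_def
  proof (rule sum_strict_mono_ex1)
    have lt: "s l * \<beta>t i < s l * level" if "l \<in> ?A" for l
      using * that s_pos[of l] by (intro mult_strict_left_mono) auto
    then show "\<forall>l\<in>?A. max 0 (s l * \<beta>t i - c l) \<le> max 0 (s l * level - c l)"
      by fastforce
    \<comment> \<open>Strict growth needs one user whose clamp at 0 is inactive at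
      \<open>level\<close>; any active user serves.\<close>
    have "s k * level - c k > 0"
      using beta_less_level[OF k] le_beta_iff[of k level] k active_subset by force
    then show "\<exists>l\<in>?A. max 0 (s l * \<beta>t i - c l) < max 0 (s l * level - c l)"
      using lt[of k] k active_subset by (intro bexI[of _ k]) auto
  qed simp
  finally show False using uncapped_level by simp
qed

end

text \<open>The multiplier is 0 if every user is saturated, since the budget may then be slack.
  Otherwise the budget is exhausted and the multiplier is determined by
  \<open>level\<close>.\<close>

theorem unique_arg_min:
  assumes z_sat: "\<And>i. i \<in> saturated \<Longrightarrow> \<xi> i * z i = Pmax"
    and z_act: "saturated \<noteq> {1..n} \<Longrightarrow> (\<And>i. i \<in> active \<Longrightarrow> \<xi> i * z i = s i * level - c i)"
    and z_idle: "\<And>i. i \<in> {1..n} - (saturated \<union> active) \<Longrightarrow> z i = 0"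
  shows "is_arg_min (objective n a b) (feasible n \<xi> Ptot Pmax) z \<and>
         (\<forall>w. is_arg_min (objective n a b) (feasible n \<xi> Ptot Pmax) w \<longrightarrow> (\<forall>i\<in>{1..n}. w i = z i))"
proof (cases "saturated = {1..n}")
  case True
  have "real n * Pmax \<le> Ptot"
    using residual_pos True by (simp add: residual_def)
  moreover have "0 \<le> z i" if "i \<in> {1..n}" for i
    using z_sat[of i] True that pos[of i] Pmax by (metis less_imp_le zero_less_mult_pos)
  ultimately have "feasible n \<xi> Ptot Pmax z"
    using True z_sat by (simp add: feasible_def)
  with pos show ?thesis
    by (rule unique_arg_min_if_KKT[where \<mu> = 0]) (use True z_sat in \<open>auto simp: pos less_imp_le\<close>)
next
  case False
  note z_act = z_act[OF False]
  \<comment> \<open>The three classes are the three branches of the clamp: \<open>level\<close> at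
    or above \<open>\<beta>t i\<close>, between the thresholds, or at or below
    \<open>\<beta> i\<close>.\<close>
  have power: "\<xi> i * z i = max 0 (min Pmax (s i * level - c i))" if i: "i \<in> {1..n}" for i
  proof -
    consider "i \<in> saturated" | "i \<in> active" | "i \<in> {1..n} - saturated - active" using i by blast
    then show ?thesis
    proof cases
      case 1
      then show ?thesis
        using beta_tilde_le_level[OF False 1] beta_tilde_le_iff[OF i] z_sat[OF 1] Pmax by auto
    next
      case 2
      then have "s i * level - c i \<le> Pmax"
        using level_le_beta_tilde[OF False] le_beta_tilde_iff[OF i] active_subset by blast
      moreover have "0 < s i * level - c i"
        using beta_less_level[OF False 2] le_beta_iff[OF i, of level] by linarith
      ultimately show ?thesis using z_act[OF 2] by simp
    next
      case 3
      then show ?thesis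
        using level_le_beta[OF False 3] le_beta_iff[OF i] z_idle[of i] by auto
    qed
  qed
  have "(\<Sum>i=1..n. \<xi> i * z i) = capped {1..n} level"
    unfolding capped_def by (intro sum.cong refl power)
  also have "\<dots> = real (card saturated) * Pmax + uncapped ({1..n} - saturated) level"
    unfolding capped_split
    using capped_eq_card[of saturated level] saturated_subset beta_tilde_le_level[OF False]
      capped_eq_uncapped[of "{1..n} - saturated" level] level_le_beta_tilde[OF False]
    by simp
  finally have total: "(\<Sum>i=1..n. \<xi> i * z i) = Ptot"
    using uncapped_level[OF False] by (simp add: residual_def)
  have nonneg: "0 \<le> z i" if "i \<in> {1..n}" for i
  proof -
    have "0 \<le> \<xi> i * z i" using power[OF that] by simp
    then show ?thesis using pos[OF that] by (simp add: zero_le_mult_iff)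
  qed
  have feas: "feasible n \<xi> Ptot Pmax z"
    using total nonneg power Pmax by (simp add: feasible_def)
  have marginal: "a i * b i / (z i + b i)\<^sup>2 = (s i / (\<xi> i * z i + c i))\<^sup>2 * \<xi> i"
    if "i \<in> {1..n}" for i
  proof -
    have "\<xi> i * z i + c i = \<xi> i * (z i + b i)" "z i + b i > 0" "(s i)\<^sup>2 = a i * b i * \<xi> i"
      using pos[OF that] nonneg[OF that] by (auto simp: c_def s_def algebra_simps)
    then show ?thesis
      using pos[OF that] by (simp add: power_divide power_mult_distrib power2_eq_square)
  qed
  have pc: "\<xi> i * z i + c i > 0" if "i \<in> {1..n}" for i
    using power[OF that] c_pos[OF that] by linarith
  note t = level_pos[OF False]
  \<comment> \<open>In terms of power \<open>p\<close>, the marginal gain is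
    \<open>(s i / (p + c i))\<^sup>2\<close>. At the unclamped \<open>p = s i * level - c i\<close>
    this equals \<open>(1 / level)\<^sup>2\<close> for every user, whence the multiplier.\<close>
  show ?thesis
  proof (rule unique_arg_min_if_KKT[OF pos feas, where \<mu> = "(1 / level)\<^sup>2"])
    fix i assume i: "i \<in> {1..n}"
    {
      assume "\<xi> i * z i < Pmax"
      then have "s i * level \<le> \<xi> i * z i + c i"
        using power[OF i] by linarith
      then have "s i / (\<xi> i * z i + c i) \<le> 1 / level"
        using t pc[OF i] by (simp add: field_simps)
      then have "(s i / (\<xi> i * z i + c i))\<^sup>2 \<le> (1 / level)\<^sup>2"
        using s_pos[OF i] pc[OF i] by (intro power_mono) auto
      then show "a i * b i / (z i + b i)\<^sup>2 \<le> (1 / level)\<^sup>2 * \<xi> i"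
        unfolding marginal[OF i] using pos[OF i] by (intro mult_right_mono) auto
    next
      assume "0 < z i"
      then have "0 < \<xi> i * z i" using pos[OF i] by simp
      then have "\<xi> i * z i + c i \<le> s i * level"
        using power[OF i] by linarith
      then have "1 / level \<le> s i / (\<xi> i * z i + c i)"
        using t pc[OF i] by (simp add: field_simps)
      then have "(1 / level)\<^sup>2 \<le> (s i / (\<xi> i * z i + c i))\<^sup>2"
        using t by (intro power_mono) auto
      then show "(1 / level)\<^sup>2 * \<xi> i \<le> a i * b i / (z i + b i)\<^sup>2"
        unfolding marginal[OF i] using pos[OF i] by (intro mult_right_mono) auto
    }
  qed (use total in auto)
qed

section \<open>Stage 1 finds the saturated users\<close>

lemma f_tilde_less_1_iff:
  assumes u: "sorted_listing n {1..n} \<beta>t u"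
    and i: "i \<in> {1..n}" "real i * Pmax \<le> Ptot"
  shows "f_tilde n a b \<xi> Ptot Pmax u i < 1 \<longleftrightarrow> capped {1..n} (\<beta>t (u i)) < Ptot"
proof -
  let ?S = "S_tilde n a b \<xi> Pmax u i" and ?t = "\<beta>t (u i)"
  have bij: "bij_betw u {1..n} {1..n}" and mono:
    "\<And>k l. k \<in> {1..n} \<Longrightarrow> l \<in> {1..n} \<Longrightarrow> k \<le> l \<Longrightarrow> \<beta>t (u k) \<le> \<beta>t (u l)"
    using u by (auto simp: sorted_listing_def mono_on_def)
  have u_in: "u k \<in> {1..n}" if "k \<in> {1..n}" for k
    using bij that by (rule bij_betwE[rule_format])
  have inj: "inj_on u {1..n}" using bij by (rule bij_betw_imp_inj_on)
  have S: "?S \<subseteq> {i<..n}" "finite ?S"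
    by (auto simp: S_tilde_def)
  have inj_S: "inj_on u ?S"
    using S(1) by (intro inj_on_subset[OF inj]) auto
  have split: "{1..n} = u ` {1..i} \<union> u ` {i<..n}"
  proof -
    have "{1..n} = {1..i} \<union> {i<..n}" using i(1) by auto
    then show ?thesis using bij by (metis bij_betw_imp_surj_on image_Un)
  qed
  have disj: "u ` {1..i} \<inter> u ` {i<..n} = {}"
    using inj i(1) by (subst inj_on_image_Int[symmetric, OF inj]) auto
  have card1: "card (u ` {1..i}) = i"
    using i(1) by (subst card_image) (auto intro: inj_on_subset[OF inj])
  \<comment> \<open>At the threshold of \<open>u i\<close>, the first \<open>i\<close> users in the
    listing are at their caps and the later ones do not exceed theirs; among the later ones only
    those in \<open>?S\<close> spend anything.\<close>
  have "capped {1..n} ?t = capped (u ` {1..i}) ?t + capped (u ` {i<..n}) ?t"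
    unfolding capped_def by (subst split) (use disj in \<open>auto intro: sum.union_disjoint\<close>)
  also have "capped (u ` {1..i}) ?t = real i * Pmax"
    using capped_eq_card[of "u ` {1..i}" ?t] card1 i u_in mono by fastforce
  also have "capped (u ` {i<..n}) ?t = uncapped (u ` {i<..n}) ?t"
    using i u_in mono by (intro capped_eq_uncapped) auto
  also have "\<dots> = (\<Sum>k\<in>u ` ?S. s k) * ?t - (\<Sum>k\<in>u ` ?S. c k)"
    using S i u_in by (intro uncapped_eq_sum) (auto simp: S_tilde_def not_less intro: less_imp_le)
  also have "\<dots> = (\<Sum>m\<in>?S. s (u m)) * ?t - (\<Sum>m\<in>?S. c (u m))"
    by (simp add: sum.reindex inj_S)
  finally have cap: "capped {1..n} ?t = real i * Pmax + ((\<Sum>m\<in>?S. s (u m)) * ?t - (\<Sum>m\<in>?S. c (u m)))" .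
  define num where "num = ?t * (\<Sum>m\<in>?S. s (u m))"
  define den where "den = Ptot - real i * Pmax + (\<Sum>m\<in>?S. c (u m))"
  have f: "f_tilde n a b \<xi> Ptot Pmax u i = (if num = 0 \<and> den = 0 then 1 else num / den)"
    by (simp add: f_tilde_def num_def den_def s_def c_def Let_def)
  have "capped {1..n} ?t < Ptot \<longleftrightarrow> num < den"
    unfolding cap num_def den_def by (auto simp: mult.commute)
  \<comment> \<open>For empty \<open>?S\<close> the numerator is 0 and the denominator may be 0 too.
    The value 1 then makes the test fail, as \<open>num < den\<close> does, whereas plain division
    would return 0. Otherwise the denominator is positive.\<close>
  moreover have "f_tilde n a b \<xi> Ptot Pmax u i < 1 \<longleftrightarrow> num < den"
  proof (cases "?S = {}")
    case True
    then show ?thesis using i(2) f by (auto simp: num_def den_def)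
  next
    case False
    then have "(\<Sum>m\<in>?S. c (u m)) > 0"
      using S u_in c_pos by (intro sum_pos) auto
    then have "den > 0" using i(2) by (simp add: den_def)
    then show ?thesis using f by simp
  qed
  ultimately show ?thesis by simp
qed

lemma S_one_eq_saturated:
  assumes u: "sorted_listing n {1..n} \<beta>t u"
  shows "S_one n a b \<xi> Ptot Pmax u = saturated"
proof -
  have bij: "bij_betw u {1..n} {1..n}" and mono:
    "\<And>k l. k \<in> {1..n} \<Longrightarrow> l \<in> {1..n} \<Longrightarrow> k \<le> l \<Longrightarrow> \<beta>t (u k) \<le> \<beta>t (u l)"
    using u by (auto simp: sorted_listing_def mono_on_def)
  have u_in: "u k \<in> {1..n}" if "k \<in> {1..n}" for k
    using bij that by (rule bij_betwE[rule_format])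
  define I where "I = {i \<in> {1..min n (nat \<lfloor>Ptot / Pmax\<rfloor>)}. f_tilde n a b \<xi> Ptot Pmax u i < 1}"
  have range: "i \<le> nat \<lfloor>Ptot / Pmax\<rfloor> \<longleftrightarrow> real i * Pmax \<le> Ptot" for i
    using Pmax Ptot by (simp add: le_nat_iff le_floor_iff pos_le_divide_eq)
  \<comment> \<open>The floor bound on the search range loses no saturated user: at the threshold of
    \<open>u i\<close> the users \<open>u 1\<close> to \<open>u i\<close> already spend
    \<open>Pmax\<close> each.\<close>
  have "real i * Pmax \<le> Ptot" if "i \<in> {1..n}" "capped {1..n} (\<beta>t (u i)) < Ptot" for i
  proof -
    have inj: "inj_on u {1..i}"
      by (rule inj_on_subset[OF bij_betw_imp_inj_on[OF bij]]) (use that in auto)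
    have "capped (u ` {1..i}) (\<beta>t (u i)) = real i * Pmax"
      using capped_eq_card[of "u ` {1..i}" "\<beta>t (u i)"] card_image[OF inj] that(1) u_in mono by fastforce
    moreover have "u ` {1..i} \<subseteq> {1..n}"
      using that(1) u_in by (intro image_subsetI) simp
    then have "capped (u ` {1..i}) (\<beta>t (u i)) \<le> capped {1..n} (\<beta>t (u i))"
      unfolding capped_def by (intro sum_mono2) auto
    ultimately show ?thesis using that(2) by simp
  qed
  then have I: "I = {i \<in> {1..n}. u i \<in> saturated}"
    using f_tilde_less_1_iff[OF u] u_in by (auto simp: I_def saturated_def range)
  \<comment> \<open>Saturated users have strictly smaller \<open>\<beta>t\<close> than the others,
    so \<open>I\<close> is an initial segment and its maximum determines it.\<close>
  have down: "k \<in> I" if "i \<in> I" "k \<in> {1..i}" for i k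
  proof -
    have i: "i \<in> {1..n}" "u i \<in> saturated" using that(1) by (auto simp: I)
    then have k: "k \<in> {1..n}" "k \<le> i" using that(2) by auto
    then have "\<not> \<beta>t (u i) < \<beta>t (u k)" using mono[OF k(1) i(1)] by simp
    with beta_tilde_saturated_less[OF i(2), of "u k"] u_in[OF k(1)] k(1) show ?thesis
      by (auto simp: I)
  qed
  have "finite I" by (simp add: I)
  have i_S: "i_S n a b \<xi> Ptot Pmax u = (if I = {} then 0 else Max I)"
    unfolding i_S_def Let_def I_def ..
  have "{1..i_S n a b \<xi> Ptot Pmax u} = I"
  proof (cases "I = {}")
    case True
    then show ?thesis by (simp add: i_S)
  next
    case False
    then have "i_S n a b \<xi> Ptot Pmax u = Max I" by (simp add: i_S)
    moreover have "k \<in> {1..Max I} \<longleftrightarrow> k \<in> I" for k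
    proof
      show "k \<in> I" if "k \<in> {1..Max I}"
        using Max_in[OF \<open>finite I\<close> False] that by (rule down)
      show "k \<in> {1..Max I}" if "k \<in> I"
        using that Max_ge[OF \<open>finite I\<close> that] by (simp add: I)
    qed
    ultimately show ?thesis by (simp only: set_eq_iff simp_thms)
  qed
  then have "S_one n a b \<xi> Ptot Pmax u = u ` I" by (simp add: S_one_def)
  also have "\<dots> = saturated"
  proof
    show "u ` I \<subseteq> saturated" by (auto simp: I)
    show "saturated \<subseteq> u ` I"
    proof
      fix x assume x: "x \<in> saturated"
      then obtain i where "i \<in> {1..n}" "x = u i"
        using saturated_subset bij_betw_imp_surj_on[OF bij] by blast
      with x show "x \<in> u ` I" unfolding I by blast
    qed
  qed
  finally show ?thesis .
qed

section \<open>Stage 2 finds the active users\<close>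

lemma f_two_less_1_iff:
  assumes j: "sorted_listing k A \<beta> j" and A: "A \<subseteq> {1..n}" and P: "P > 0" and l: "l \<in> {1..k}"
  shows "f_two a b \<xi> P j l < 1 \<longleftrightarrow> uncapped A (\<beta> (j l)) < P"
proof -
  have bij: "bij_betw j {1..k} A" and mono:
    "\<And>i l. i \<in> {1..k} \<Longrightarrow> l \<in> {1..k} \<Longrightarrow> i \<le> l \<Longrightarrow> \<beta> (j i) \<le> \<beta> (j l)"
    using j by (auto simp: sorted_listing_def mono_on_def)
  have j_in: "j i \<in> A" if "i \<in> {1..k}" for i
    using bij that by (rule bij_betwE[rule_format])
  have inj: "inj_on j {1..l}"
    by (rule inj_on_subset[OF bij_betw_imp_inj_on[OF bij]]) (use l in auto)
  have below: "m \<in> {1..k}" "\<beta> (j m) \<le> \<beta> (j l)" if "m \<in> {1..l}" for m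
  proof -
    show m: "m \<in> {1..k}" using that l by simp
    show "\<beta> (j m) \<le> \<beta> (j l)" using mono[OF m l] that by simp
  qed
  \<comment> \<open>With \<open>below\<close>, this shows that at level \<open>\<beta> (j l)\<close>
    exactly the first \<open>l\<close> listed users can contribute. Ties are harmless, since a user
    contributes 0 at its own threshold.\<close>
  have above: "\<beta> (j l) \<le> \<beta> i" if i: "i \<in> A - j ` {1..l}" for i
  proof -
    obtain m where m: "m \<in> {1..k}" "i = j m"
      using i bij_betw_imp_surj_on[OF bij] by blast
    then have "m \<notin> {1..l}" using i by blast
    then show ?thesis using m mono[OF l m(1)] by simp
  qed
  have "uncapped A (\<beta> (j l)) = (\<Sum>i\<in>j ` {1..l}. s i) * \<beta> (j l) - (\<Sum>i\<in>j ` {1..l}. c i)"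
  proof (rule uncapped_eq_sum[OF A])
    show "j ` {1..l} \<subseteq> A" using j_in below(1) by blast
  qed (use below(2) above in blast)+
  also have "\<dots> = (\<Sum>i=1..l. s (j i)) * \<beta> (j l) - (\<Sum>i=1..l. c (j i))"
    unfolding sum.reindex[OF inj] by simp
  finally have "uncapped A (\<beta> (j l)) = (\<Sum>i=1..l. s (j i)) * \<beta> (j l) - (\<Sum>i=1..l. c (j i))" .
  moreover have "(\<Sum>i=1..l. c (j i)) \<ge> 0"
    by (intro sum_nonneg less_imp_le[OF c_pos] subsetD[OF A] j_in below(1))
  moreover have "f_two a b \<xi> P j l = \<beta> (j l) * (\<Sum>i=1..l. s (j i)) / (P + (\<Sum>i=1..l. c (j i)))"
    by (simp add: f_two_def s_def c_def)
  ultimately show ?thesis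
    using P by (auto simp: mult.commute pos_divide_less_eq add_pos_nonneg)
qed

lemma S_two_eq_active:
  assumes j: "sorted_listing k ({1..n} - saturated) \<beta> j" and unsat: "saturated \<noteq> {1..n}"
  shows "S_two a b \<xi> residual k j = active"
proof -
  let ?A = "{1..n} - saturated"
  let ?f = "f_two a b \<xi> residual j"
  have bij: "bij_betw j {1..k} ?A" and mono:
    "\<And>i l. i \<in> {1..k} \<Longrightarrow> l \<in> {1..k} \<Longrightarrow> i \<le> l \<Longrightarrow> \<beta> (j i) \<le> \<beta> (j l)"
    using j by (auto simp: sorted_listing_def mono_on_def)
  have j_in: "j i \<in> ?A" if "i \<in> {1..k}" for i
    using bij that by (rule bij_betwE[rule_format])
  have f_iff: "?f l < 1 \<longleftrightarrow> j l \<in> active" if "l \<in> {1..k}" for l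
    using f_two_less_1_iff[OF j Diff_subset residual_pos that] j_in[OF that] by (simp add: active_def)
  have down: "?f i < 1" if "?f l < 1" "l \<in> {1..k}" "i \<in> {1..l}" for i l
  proof -
    have i: "i \<in> {1..k}" using that by auto
    have "uncapped ?A (\<beta> (j i)) \<le> uncapped ?A (\<beta> (j l))"
      using that(3) by (intro uncapped_mono mono[OF i that(2)]) auto
    with that i show ?thesis
      using f_iff[of l] f_iff[OF i] j_in[OF i] by (auto simp: active_def)
  qed
  have active_eq: "active = j ` {l \<in> {1..k}. ?f l < 1}"
  proof
    show "active \<subseteq> j ` {l \<in> {1..k}. ?f l < 1}"
    proof
      fix x assume x: "x \<in> active"
      then obtain l where "l \<in> {1..k}" "x = j l"
        using active_subset bij_betw_imp_surj_on[OF bij] by blast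
      with x f_iff show "x \<in> j ` {l \<in> {1..k}. ?f l < 1}" by blast
    qed
    show "j ` {l \<in> {1..k}. ?f l < 1} \<subseteq> active" using f_iff by blast
  qed
  show ?thesis
  proof (cases "?f k < 1")
    case True
    have "?f l < 1" if "l \<in> {1..k}" for l
      using down[OF True _ that] that by simp
    then have "{l \<in> {1..k}. ?f l < 1} = {1..k}" by blast
    then show ?thesis using True active_eq by (simp add: S_two_def)
  next
    case False
    define L where "L = {l \<in> {1..k}. ?f l < 1}"
    have fin: "finite L" by (simp add: L_def)
    \<comment> \<open>Nonemptiness, together with failure of the test at \<open>k\<close>,
      guarantees a crossing for the description operator to select.\<close>
    have "L \<noteq> {}" using active_nonempty[OF unsat] active_eq by (auto simp: L_def)
    then have Max: "Max L \<in> L" using fin by simp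
    then have lt: "1 \<le> Max L" "Max L \<le> k" "?f (Max L) < 1"
      by (simp_all add: L_def)
    with False have "Max L < k" by (metis le_neq_implies_less)
    note lt = lt(1) this lt(3)
    have "Max L + 1 \<notin> L" using Max_ge[OF fin, of "Max L + 1"] by auto
    then have ge: "?f (Max L + 1) \<ge> 1" using lt by (auto simp: L_def)
    have "(THE l. 1 \<le> l \<and> l < k \<and> ?f l < 1 \<and> ?f (l + 1) \<ge> 1) = Max L"
    proof (rule the_equality)
      fix l assume l: "1 \<le> l \<and> l < k \<and> ?f l < 1 \<and> ?f (l + 1) \<ge> 1"
      then have "l \<le> Max L" using fin by (auto simp: L_def)
      \<comment> \<open>A crossing before \<open>Max L\<close> would have
        \<open>l + 1 \<le> Max L\<close>, so \<open>down\<close> would give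
        \<open>?f (l + 1) < 1\<close>.\<close>
      moreover have "\<not> l < Max L"
        using down[OF lt(3), of "l + 1"] lt l by auto
      ultimately show "l = Max L" by simp
    qed (use lt ge in simp)
    moreover have "{1..Max L} = L"
    proof
      show "{1..Max L} \<subseteq> L"
      proof
        fix l assume l: "l \<in> {1..Max L}"
        then have "l \<in> {1..k}" using lt(2) by simp
        moreover have "?f l < 1" by (rule down[OF lt(3) _ l]) (use lt in simp)
        ultimately show "l \<in> L" by (simp add: L_def)
      qed
      show "L \<subseteq> {1..Max L}" using Max_ge[OF fin] by (intro subsetI) (simp add: L_def)
    qed
    ultimately have "S_two a b \<xi> residual k j = j ` L"
      using False by (simp only: S_two_def if_False)
    then show ?thesis using active_eq by (simp only: L_def)
  qed
qed

end

section \<open>Translation to the channel parameters\<close>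

theorem mainTheorem4:
  fixes n n' :: nat
    and \<gamma> \<kappa> a b \<xi> z :: "nat \<Rightarrow> real"
    and h :: "nat \<Rightarrow> complex"
    and \<sigma>n \<sigma>v \<sigma>t \<pi>1 Ptot Pmax P' \<eta> :: real
    and u j :: "nat \<Rightarrow> nat"
    and S1 S2 :: "nat set"
  assumes n: "n \<ge> 1"
    and \<gamma>: "\<And>i. i \<in> {1..n} \<Longrightarrow> \<gamma> i > 0"
    and h: "\<And>i. i \<in> {1..n} \<Longrightarrow> h i \<noteq> 0"
    and \<kappa>: "\<And>i. i \<in> {1..n} \<Longrightarrow> \<kappa> i > 0"
    and \<sigma>n: "\<sigma>n\<^sup>2 > 0" and \<sigma>v: "\<sigma>v\<^sup>2 > 0"
    and \<sigma>t: "\<sigma>t > 0" "\<sigma>t\<^sup>2 = \<sigma>v\<^sup>2 / \<sigma>n ^ 4"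
    and \<pi>1: "\<pi>1 = 1 / 2"
    and \<xi>: "\<And>i. i \<in> {1..n} \<Longrightarrow> \<xi> i = (1 + 2 * \<pi>1 * \<gamma> i) * \<sigma>n ^ 4"
    and a: "\<And>i. i \<in> {1..n} \<Longrightarrow> a i = \<kappa> i * (\<gamma> i)\<^sup>2"
    and b: "\<And>i. i \<in> {1..n} \<Longrightarrow> b i = \<kappa> i * \<sigma>t\<^sup>2 / (cmod (h i))\<^sup>2"
    and Ptot: "Ptot > 0" and Pmax: "Pmax > 0"
    \<comment> \<open>Stage 1\<close>
    and u: "sorted_listing n {1..n} (beta_tilde a b \<xi> Pmax) u"
    and S1: "S1 = S_one n a b \<xi> Ptot Pmax u"
    and z_S1: "\<And>i. i \<in> S1 \<Longrightarrow> z i = Pmax / \<xi> i"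
    \<comment> \<open>Stage 2\<close>
    and n': "n' = n - card S1"
    and P': "P' = Ptot - real (card S1) * Pmax"
    and j: "sorted_listing n' ({1..n} - S1) (beta a b \<xi>) j"
    and S2: "S2 = (if S1 \<noteq> {1..n} then S_two a b \<xi> P' n' j else {})"
    and \<eta>: "\<eta> = ((\<Sum>i\<in>S2. \<kappa> i * \<xi> i / (cmod (h i))\<^sup>2) + P' / \<sigma>t\<^sup>2) /
                 (\<Sum>i\<in>S2. \<kappa> i * sqrt (\<xi> i) * \<gamma> i / cmod (h i))"
    and z_S2: "\<And>i. i \<in> S2 \<Longrightarrow>
                 z i = \<kappa> i * \<sigma>t\<^sup>2 / (cmod (h i))\<^sup>2 * (\<gamma> i * cmod (h i) / sqrt (\<xi> i) * \<eta> - 1)"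
    and z_0: "\<And>i. i \<in> {1..n} - (S1 \<union> S2) \<Longrightarrow> z i = 0"
  shows "is_arg_min (objective n a b) (feasible n \<xi> Ptot Pmax) z \<and>
         (\<forall>w. is_arg_min (objective n a b) (feasible n \<xi> Ptot Pmax) w \<longrightarrow> (\<forall>i\<in>{1..n}. w i = z i))"
proof -
  have \<sigma>n4: "\<sigma>n ^ 4 > 0"
    using \<sigma>n by (metis numeral_Bit0 power_add zero_less_mult_iff mult_2 power_even_eq zero_less_power)
  have pos: "a i > 0 \<and> b i > 0 \<and> \<xi> i > 0" if "i \<in> {1..n}" for i
    using that \<sigma>n4 \<gamma>[OF that] \<kappa>[OF that] h[OF that] \<sigma>t(1)
    by (simp add: a b \<xi> \<pi>1 add_pos_pos)
  interpret water_filling n a b \<xi> Ptot Pmax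
    by standard (use pos Ptot Pmax in auto)
  have S1: "S1 = saturated"
    using S_one_eq_saturated[OF u] S1 by simp
  have P': "P' = residual"
    by (simp add: P' S1 residual_def)
  \<comment> \<open>If everyone is saturated, \<open>active\<close> lies in an empty set and so
    agrees with the skipped stage 2.\<close>
  have S2: "S2 = active"
  proof (cases "saturated = {1..n}")
    case True
    then show ?thesis using active_subset S2 S1 by auto
  next
    case False
    then show ?thesis using S_two_eq_active[of n' j] j S2 S1 P' by simp
  qed
  have s_eq: "s i = \<kappa> i * sqrt (\<xi> i) * \<gamma> i / cmod (h i) * \<sigma>t" if "i \<in> {1..n}" for i
  proof -
    have "a i * b i * \<xi> i = (\<kappa> i * sqrt (\<xi> i) * \<gamma> i / cmod (h i) * \<sigma>t)\<^sup>2"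
      using pos[OF that] by (simp add: a[OF that] b[OF that] power_mult_distrib power_divide power2_eq_square)
    moreover have "0 \<le> \<kappa> i * sqrt (\<xi> i) * \<gamma> i / cmod (h i) * \<sigma>t"
      using pos[OF that] \<gamma>[OF that] \<kappa>[OF that] \<sigma>t(1) by simp
    ultimately show ?thesis unfolding s_def by (metis real_sqrt_unique)
  qed
  have c_eq: "c i = \<kappa> i * \<xi> i / (cmod (h i))\<^sup>2 * \<sigma>t\<^sup>2" if "i \<in> {1..n}" for i
    by (simp add: c_def b[OF that])
  have act: "i \<in> {1..n}" if "i \<in> active" for i
    using that active_subset by blast
  have sum_s: "(\<Sum>i\<in>active. s i) = (\<Sum>i\<in>active. \<kappa> i * sqrt (\<xi> i) * \<gamma> i / cmod (h i)) * \<sigma>t"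
    unfolding sum_distrib_right by (intro sum.cong refl s_eq act)
  have sum_c: "(\<Sum>i\<in>active. c i) = (\<Sum>i\<in>active. \<kappa> i * \<xi> i / (cmod (h i))\<^sup>2) * \<sigma>t\<^sup>2"
    unfolding sum_distrib_right by (intro sum.cong refl c_eq act)
  \<comment> \<open>Each \<open>s i\<close> carries one factor \<open>\<sigma>t\<close> and each
    \<open>c i\<close> two, so one factor remains. The case \<open>D = 0\<close> covers an empty
    \<open>S2\<close>, where both sides are 0.\<close>
  have level_eq: "level = \<sigma>t * \<eta>"
  proof -
    have "(R + C * \<sigma>t\<^sup>2) / (D * \<sigma>t) = \<sigma>t * ((C + R / \<sigma>t\<^sup>2) / D)" for R C D
      using \<sigma>t(1) by (cases "D = 0") (simp_all add: field_simps power2_eq_square)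
    then show ?thesis unfolding level_def sum_s sum_c \<eta> S2 P' .
  qed
  show ?thesis
  proof (rule unique_arg_min)
    fix i assume "i \<in> saturated"
    then show "\<xi> i * z i = Pmax"
      using z_S1[of i] pos[of i] saturated_subset S1 by auto
  next
    fix i assume i: "i \<in> active"
    note q = pos[OF act[OF i]] h[OF act[OF i]]
    have "\<xi> i / sqrt (\<xi> i) = sqrt (\<xi> i)" by (simp add: real_div_sqrt q less_imp_le)
    have "\<xi> i * z i = \<kappa> i * \<sigma>t\<^sup>2 / (cmod (h i))\<^sup>2 * (\<gamma> i * cmod (h i) * (\<xi> i / sqrt (\<xi> i)) * \<eta> - \<xi> i)"
    proof -
      have "x * (B * (G / r * e - 1)) = B * (G * (x / r) * e - x)" for B G r x e :: real
        by (cases "r = 0") (simp_all add: field_simps)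
      with z_S2[of i] i S2 show ?thesis by simp
    qed
    also have "\<dots> = \<kappa> i * \<sigma>t\<^sup>2 / (cmod (h i))\<^sup>2 * (\<gamma> i * cmod (h i) * sqrt (\<xi> i) * \<eta> - \<xi> i)"
      using \<open>\<xi> i / sqrt (\<xi> i) = sqrt (\<xi> i)\<close> by simp
    also have "\<dots> = s i * level - c i"
      unfolding s_eq[OF act[OF i]] c_eq[OF act[OF i]] level_eq
      using q by (simp add: field_simps power2_eq_square)
    finally show "\<xi> i * z i = s i * level - c i" .
  next
    fix i assume "i \<in> {1..n} - (saturated \<union> active)"
    then show "z i = 0" using z_0 S1 S2 by simp
  qed
qed

end
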